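(* Let $G$ be a finite group that contains a normal subgroup $A$ such that $C_G(A) \le A$ and $[A,x]$ is a normal subset of $A$ for all small elements $x \in G$. Then $M(G)$ is nilpotent, and it has nilpotency class at most $3$.
   Context: For a finite group $G$, an element $x \in G$ is called small if $x$ is non-central and its conjugacy class has the smallest size among all conjugacy classes of non-central elements of $G$. $M(G)$ denotes the subgroup of $G$ generated by all small elements of $G$ (trivial if there are none). $C_G(A)$ is the centralizer of $A$ in $G$. Commutators are $[x,h] = x^{-1}h^{-1}xh$. For $x \in G$ and a subgroup $A \le G$, $[A,x]$ denotes the set $\{[a,x] : a \in A\}$ (a set, not the subgroup it generates). A subset $S$ of a group $H$ is normal (in $H$) if $h^{-1}Sh = S$ for all $h \in H$. *)

theory Defs
  imports "HOL-Algebra.Generated_Groups"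
begin

definition centralizer :: "('a, 'b) monoid_scheme \<Rightarrow> 'a set \<Rightarrow> 'a set" where
  "centralizer G S = {g \<in> carrier G. \<forall>s\<in>S. g \<otimes>\<^bsub>G\<^esub> s = s \<otimes>\<^bsub>G\<^esub> g}"

definition group_center :: "('a, 'b) monoid_scheme \<Rightarrow> 'a set" where
  "group_center G = centralizer G (carrier G)"

definition conj_class :: "('a, 'b) monoid_scheme \<Rightarrow> 'a \<Rightarrow> 'a set" where
  "conj_class G x = {inv\<^bsub>G\<^esub> g \<otimes>\<^bsub>G\<^esub> x \<otimes>\<^bsub>G\<^esub> g | g. g \<in> carrier G}"

definition small_elements :: "('a, 'b) monoid_scheme \<Rightarrow> 'a set" where
  "small_elements G =
    {x \<in> carrier G - group_center G.
       \<forall>y \<in> carrier G - group_center G. card (conj_class G x) \<le> card (conj_class G y)}"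

definition small_subgroup :: "('a, 'b) monoid_scheme \<Rightarrow> 'a set" where
  "small_subgroup G = generate G (small_elements G)"

text \<open>The convention is \<open>[x, h] = x\<inverse> h\<inverse> x h\<close>; the one behind the library's
  \<^const>\<open>derived_set\<close> is \<open>x h x\<inverse> h\<inverse>\<close>.\<close>

definition commutator :: "('a, 'b) monoid_scheme \<Rightarrow> 'a \<Rightarrow> 'a \<Rightarrow> 'a" where
  "commutator G x h = inv\<^bsub>G\<^esub> x \<otimes>\<^bsub>G\<^esub> inv\<^bsub>G\<^esub> h \<otimes>\<^bsub>G\<^esub> x \<otimes>\<^bsub>G\<^esub> h"

text \<open>A set of commutators, not the subgroup it generates.\<close>

definition commutators_with :: "('a, 'b) monoid_scheme \<Rightarrow> 'a set \<Rightarrow> 'a \<Rightarrow> 'a set" where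
  "commutators_with G A x = {commutator G a x | a. a \<in> A}"

text \<open>Here \<open>H\<close> is meant to be (the carrier of) a subgroup of \<open>G\<close>.\<close>

definition normal_subset :: "('a, 'b) monoid_scheme \<Rightarrow> 'a set \<Rightarrow> 'a set \<Rightarrow> bool" where
  "normal_subset G H S \<longleftrightarrow>
     S \<subseteq> H \<and> (\<forall>h\<in>H. {inv\<^bsub>G\<^esub> h \<otimes>\<^bsub>G\<^esub> s \<otimes>\<^bsub>G\<^esub> h | s. s \<in> S} = S)"

text \<open>The indexing starts at \<open>0\<close> with the whole group, so that the class of a nilpotent group is
  the first index at which the series is trivial.\<close>

primrec lower_central :: "('a, 'b) monoid_scheme \<Rightarrow> nat \<Rightarrow> 'a set" where
  "lower_central G 0 = carrier G"
| "lower_central G (Suc n) =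
     generate G {commutator G x g | x g. x \<in> lower_central G n \<and> g \<in> carrier G}"

definition nilpotent_group :: "('a, 'b) monoid_scheme \<Rightarrow> bool" where
  "nilpotent_group G \<longleftrightarrow> group G \<and> (\<exists>n. lower_central G n = {\<one>\<^bsub>G\<^esub>})"

text \<open>Meaningful for nilpotent groups only.\<close>

definition nilpotency_class :: "('a, 'b) monoid_scheme \<Rightarrow> nat" where
  "nilpotency_class G = (LEAST n. lower_central G n = {\<one>\<^bsub>G\<^esub>})"

end

theory Submission
  imports Defs "HOL-Algebra.SndIsomorphismGrp"
begin

text \<open>
  The heart of the matter is that \<^term>\<open>commutator G a x\<close> is central in \<open>G\<close> whenever
  \<open>a \<in> A\<close> and \<open>x\<close> is small. Let \<open>C\<close> be the centralizer of \<open>x\<close>, let \<open>H = A C\<close>, and let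
  \<open>T = [A, x]\<close>. Since \<open>C\<close> fixes \<open>x\<close>, conjugation by \<open>C\<close> maps \<open>[a, x]\<close> to \<open>[a\<^sup>c, x]\<close>, so
  it preserves \<open>T\<close>; the normality hypothesis says that \<open>A\<close> preserves \<open>T\<close> as well. Hence
  \<open>H\<close> acts on \<open>T\<close> by conjugation. The size of \<open>T\<close> is that of the \<open>A\<close>-orbit of \<open>x\<close>, which is
  the whole \<open>H\<close>-orbit of \<open>x\<close> and so has size \<open>|H| / |C|\<close>. An element \<open>y \<noteq> 1\<close> of \<open>T\<close> has
  its \<open>H\<close>-orbit inside \<open>T - {1}\<close>, which is strictly smaller; so more than \<open>|C|\<close> elements
  of \<open>H\<close> commute with \<open>y\<close>, and the class of \<open>y\<close> in \<open>G\<close> is smaller than that of \<open>x\<close>.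
  By the minimality of small classes, \<open>y\<close> is central
  (\<open>card_centralizer_commutator_less\<close>, \<open>commutator_small_central\<close>).

  The rest is formal. Write \<open>M\<close> for the subgroup generated by the small elements and \<open>Z\<close>
  for the centre of \<open>G\<close>. Centrality of commutators passes from the generators to all of \<open>M\<close>
  (\<open>commutator_generate_central\<close>), so each element of \<open>M\<close> multiplies each \<open>a \<in> A\<close> by a
  central factor. Such multiplications commute with each other, so \<open>[M, M]\<close> centralizes \<open>A\<close>
  (\<open>commutator_centralizes\<close>) and therefore lies in \<open>A\<close>. Then \<open>[M, M, M]\<close> lies in
  \<open>[A, M]\<close>, hence in \<open>Z\<close>, and \<open>[M, M, M, M]\<close> is trivial.
\<close>

definition conjugate :: "('a, 'b) monoid_scheme \<Rightarrow> 'a \<Rightarrow> 'a \<Rightarrow> 'a" where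
  "conjugate G x g = inv\<^bsub>G\<^esub> g \<otimes>\<^bsub>G\<^esub> x \<otimes>\<^bsub>G\<^esub> g"

context group
begin

section \<open>Conjugation and commutators\<close>

lemma mult_inv_cancel_left:
  assumes "x \<in> carrier G" "y \<in> carrier G"
  shows "x \<otimes> (inv x \<otimes> y) = y" "inv x \<otimes> (x \<otimes> y) = y"
  using assms by (simp_all flip: m_assoc)

lemma conjugate_closed [simp]:
  "x \<in> carrier G \<Longrightarrow> g \<in> carrier G \<Longrightarrow> conjugate G x g \<in> carrier G"
  by (simp add: conjugate_def)

lemma conjugate_by_mult:
  "x \<in> carrier G \<Longrightarrow> g \<in> carrier G \<Longrightarrow> h \<in> carrier G \<Longrightarrow>
     conjugate G x (g \<otimes> h) = conjugate G (conjugate G x g) h"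
  by (simp add: conjugate_def inv_mult_group m_assoc)

lemma conjugate_mult:
  "x \<in> carrier G \<Longrightarrow> y \<in> carrier G \<Longrightarrow> g \<in> carrier G \<Longrightarrow>
     conjugate G (x \<otimes> y) g = conjugate G x g \<otimes> conjugate G y g"
  by (simp add: conjugate_def m_assoc mult_inv_cancel_left)

lemma conjugate_inv:
  "x \<in> carrier G \<Longrightarrow> g \<in> carrier G \<Longrightarrow> conjugate G (inv x) g = inv (conjugate G x g)"
  by (simp add: conjugate_def inv_mult_group m_assoc)

lemma conjugate_eq_iff:
  assumes "x \<in> carrier G" "y \<in> carrier G" "g \<in> carrier G"
  shows "conjugate G x g = y \<longleftrightarrow> x \<otimes> g = g \<otimes> y"
  using assms by (simp add: conjugate_def m_assoc inv_solve_left')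

lemma commutator_eq_conjugate_mult:
  "x \<in> carrier G \<Longrightarrow> h \<in> carrier G \<Longrightarrow> commutator G x h = inv (conjugate G h x) \<otimes> h"
  by (simp add: commutator_def conjugate_def m_assoc inv_mult_group)

lemma commutator_closed [simp]:
  "x \<in> carrier G \<Longrightarrow> h \<in> carrier G \<Longrightarrow> commutator G x h \<in> carrier G"
  by (simp add: commutator_def)

lemma conjugate_commutator:
  "x \<in> carrier G \<Longrightarrow> h \<in> carrier G \<Longrightarrow> g \<in> carrier G \<Longrightarrow>
     conjugate G (commutator G x h) g = commutator G (conjugate G x g) (conjugate G h g)"
  by (simp add: commutator_def conjugate_mult conjugate_inv)

lemma group_center_iff:
  "z \<in> group_center G \<longleftrightarrow> z \<in> carrier G \<and> (\<forall>g\<in>carrier G. z \<otimes> g = g \<otimes> z)"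
  by (auto simp: group_center_def centralizer_def)

lemma subgroup_centralizer:
  assumes "S \<subseteq> carrier G"
  shows "subgroup (centralizer G S) G"
proof (rule subgroupI)
  show "centralizer G S \<subseteq> carrier G" "centralizer G S \<noteq> {}"
    using assms by (auto simp: centralizer_def intro!: exI[of _ \<one>])
next
  fix a assume a: "a \<in> centralizer G S"
  have "inv a \<otimes> s = s \<otimes> inv a" if "s \<in> S" for s
  proof -
    have "a \<in> carrier G" "s \<in> carrier G" "a \<otimes> s = s \<otimes> a"
      using a that assms by (auto simp: centralizer_def)
    then show ?thesis by (simp add: inv_solve_left' m_assoc [symmetric]) (simp add: m_assoc)
  qed
  then show "inv a \<in> centralizer G S"
    using a by (auto simp: centralizer_def)
next
  fix a b assume ab: "a \<in> centralizer G S" "b \<in> centralizer G S"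
  have "a \<otimes> b \<otimes> s = s \<otimes> (a \<otimes> b)" if "s \<in> S" for s
  proof -
    have *: "a \<in> carrier G" "b \<in> carrier G" "s \<in> carrier G" "a \<otimes> s = s \<otimes> a" "b \<otimes> s = s \<otimes> b"
      using ab that assms by (auto simp: centralizer_def)
    have "a \<otimes> b \<otimes> s = a \<otimes> s \<otimes> b" using *(1-3,5) by (simp add: m_assoc)
    also have "\<dots> = s \<otimes> a \<otimes> b" by (simp only: *)
    finally show ?thesis using *(1-3) by (simp add: m_assoc)
  qed
  then show "a \<otimes> b \<in> centralizer G S"
    using ab by (auto simp: centralizer_def)
qed

section \<open>Counting conjugates\<close>

text \<open>The orbit-stabilizer theorem for a subgroup that acts on the ambient group by conjugation
  from the right: two elements of \<open>H\<close> conjugate \<open>x\<close> alike exactly when they differ by a left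
  factor that commutes with \<open>x\<close>.\<close>

lemma card_conjugates_mult_centralizer:
  assumes fin: "finite (carrier G)" and H: "subgroup H G" and x: "x \<in> carrier G"
  shows "card (conjugate G x ` H) * card (H \<inter> centralizer G {x}) = card H"
proof -
  have HG: "H \<subseteq> carrier G" using H by (rule subgroup.subset)
  have finH: "finite H" using fin HG finite_subset by blast
  have fibre: "card {h \<in> H. conjugate G x h = y} = card (H \<inter> centralizer G {x})"
    if "y \<in> conjugate G x ` H" for y
  proof -
    from that obtain k where k: "k \<in> H" "y = conjugate G x k" by blast
    have kG: "k \<in> carrier G" using k HG by blast
    have "bij_betw (\<lambda>c. c \<otimes> k) (H \<inter> centralizer G {x}) {h \<in> H. conjugate G x h = y}"
    proof (rule bij_betw_byWitness[where f' = "\<lambda>h. h \<otimes> inv k"])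
      show "\<forall>a\<in>H \<inter> centralizer G {x}. a \<otimes> k \<otimes> inv k = a"
        using kG HG by (auto simp: m_assoc)
      show "\<forall>a'\<in>{h \<in> H. conjugate G x h = y}. a' \<otimes> inv k \<otimes> k = a'"
        using kG HG by (auto simp: m_assoc)
      show "(\<lambda>c. c \<otimes> k) ` (H \<inter> centralizer G {x}) \<subseteq> {h \<in> H. conjugate G x h = y}"
      proof (clarify)
        fix c assume c: "c \<in> H" "c \<in> centralizer G {x}"
        then have cG: "c \<in> carrier G" and "conjugate G x c = x"
          using HG x by (auto simp: centralizer_def conjugate_eq_iff)
        then show "c \<otimes> k \<in> H \<and> conjugate G x (c \<otimes> k) = y"
          using c k x kG by (simp add: conjugate_by_mult subgroup.m_closed[OF H])
      qed
      show "(\<lambda>h. h \<otimes> inv k) ` {h \<in> H. conjugate G x h = y} \<subseteq> H \<inter> centralizer G {x}"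
      proof (clarify)
        fix h assume h: "h \<in> H" "y = conjugate G x h"
        have hG: "h \<in> carrier G" using h HG by blast
        have "conjugate G x (h \<otimes> inv k) = conjugate G (conjugate G x k) (inv k)"
          using h k hG kG x by (simp add: conjugate_by_mult)
        also have "\<dots> = x"
          using x kG by (simp add: conjugate_def m_assoc mult_inv_cancel_left)
        finally have "h \<otimes> inv k \<in> centralizer G {x}"
          using x kG hG by (auto simp: centralizer_def conjugate_eq_iff)
        then show "h \<otimes> inv k \<in> H \<inter> centralizer G {x}"
          using h k by (simp add: subgroup.m_closed[OF H] subgroup.m_inv_closed[OF H])
      qed
    qed
    then show ?thesis by (simp add: bij_betw_same_card)
  qed
  have "card H = (\<Sum>y\<in>conjugate G x ` H. card {h \<in> H. conjugate G x h = y})"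
    using sum.image_gen[OF finH, of "\<lambda>_. 1::nat" "conjugate G x"] by simp
  also have "\<dots> = card (conjugate G x ` H) * card (H \<inter> centralizer G {x})"
    using fibre by simp
  finally show ?thesis by simp
qed

lemma card_conj_class_less:
  assumes fin: "finite (carrier G)" and x: "x \<in> carrier G" and y: "y \<in> carrier G"
    and less: "card (centralizer G {x}) < card (centralizer G {y})"
  shows "card (conj_class G y) < card (conj_class G x)"
proof -
  have *: "card (conj_class G u) * card (centralizer G {u}) = card (carrier G)"
    if "u \<in> carrier G" for u
  proof -
    have "conj_class G u = conjugate G u ` carrier G"
      by (auto simp: conj_class_def conjugate_def)
    moreover have "carrier G \<inter> centralizer G {u} = centralizer G {u}"
      by (auto simp: centralizer_def)
    ultimately show ?thesis
      using card_conjugates_mult_centralizer[OF fin subgroup_self that] by simp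
  qed
  have pos: "card (carrier G) > 0" using fin by (auto simp: card_gt_0_iff)
  show ?thesis
  proof (rule ccontr)
    assume "\<not> ?thesis"
    then have "card (conj_class G x) * card (centralizer G {x})
      \<le> card (conj_class G y) * card (centralizer G {x})" by simp
    also have "\<dots> < card (conj_class G y) * card (centralizer G {y})"
      using less *[OF y] pos by (intro mult_strict_left_mono) (auto intro: Nat.gr0I)
    finally show False using *[OF x] *[OF y] by simp
  qed
qed

text \<open>The group \<open>H = A C\<close>, with \<open>C\<close> the centralizer of \<open>x\<close>, acts by conjugation both on the
  orbit of \<open>x\<close> and on the set \<open>[A, x]\<close>, and these two sets have the same size. On the second one
  the identity is a fixed point, so the orbit of \<open>y = [a, x]\<close> misses it, and is
  smaller than the orbit of \<open>x\<close>; the stabilizer of \<open>y\<close> is correspondingly larger.\<close>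

lemma card_centralizer_commutator_less:
  assumes fin: "finite (carrier G)" and A: "A \<lhd> G" and x: "x \<in> carrier G"
    and norm: "normal_subset G A (commutators_with G A x)"
    and a: "a \<in> A" and ne: "commutator G a x \<noteq> \<one>"
  shows "card (centralizer G {x}) < card (centralizer G {commutator G a x})"
proof -
  define C where "C = centralizer G {x}"
  define H where "H = A <#> C"
  define T where "T = commutators_with G A x"
  define y where "y = commutator G a x"
  have subA: "subgroup A G" using A by (rule normal_imp_subgroup)
  have AG: "A \<subseteq> carrier G" using subA by (rule subgroup.subset)
  have aG: "a \<in> carrier G" using a AG by blast
  have yG: "y \<in> carrier G" using aG x by (simp add: y_def)
  have subC: "subgroup C G" unfolding C_def using x by (intro subgroup_centralizer) simp
  have CG: "C \<subseteq> carrier G" using subC by (rule subgroup.subset)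
  interpret second_isomorphism_grp A G C
    using A subC by (simp add: second_isomorphism_grp_def second_isomorphism_grp_axioms_def)
  have subH: "subgroup H G" unfolding H_def by (rule normal_set_mult_subgroup)
  have HG: "H \<subseteq> carrier G" using subH by (rule subgroup.subset)
  have CH: "C \<subseteq> H"
  proof
    fix c assume "c \<in> C"
    moreover from this have "c = \<one> \<otimes> c" using CG by auto
    ultimately show "c \<in> H"
      unfolding H_def set_mult_def using subgroup.one_closed[OF subA] by blast
  qed
  have finH: "finite H" using fin HG finite_subset by blast
  have x_fixed: "conjugate G x c = x" if "c \<in> C" for c
    using that x by (simp add: C_def centralizer_def conjugate_eq_iff)
  have orbit_x: "conjugate G x ` H \<subseteq> conjugate G x ` A"
  proof (clarify)
    fix h assume "h \<in> H"
    then obtain b c where bc: "b \<in> A" "c \<in> C" "h = b \<otimes> c"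
      unfolding H_def set_mult_def by blast
    have G: "b \<in> carrier G" "c \<in> carrier G" using bc AG CG by auto
    \<comment> \<open>Moving \<open>c\<close> to the left, where it acts trivially on \<open>x\<close>, leaves an element of \<open>A\<close>.\<close>
    have "h = c \<otimes> conjugate G b c"
      using bc(3) G by (simp add: conjugate_def m_assoc mult_inv_cancel_left)
    then have "conjugate G x h = conjugate G x (conjugate G b c)"
      using G x bc by (simp add: conjugate_by_mult x_fixed)
    moreover have "conjugate G b c \<in> A"
      unfolding conjugate_def using normal.inv_op_closed1[OF A] G bc by blast
    ultimately show "conjugate G x h \<in> conjugate G x ` A" by blast
  qed
  \<comment> \<open>As \<open>[b, x]\<close> is the inverse of the conjugate of \<open>x\<close> by \<open>b\<close>, times \<open>x\<close>, the set \<open>T\<close> is a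
    bijective image of the \<open>A\<close>-orbit of \<open>x\<close>.\<close>
  have T_image: "T = (\<lambda>u. inv u \<otimes> x) ` conjugate G x ` A"
  proof -
    have "commutator G b x = inv (conjugate G x b) \<otimes> x" if "b \<in> A" for b
      using that AG x by (intro commutator_eq_conjugate_mult) auto
    then show ?thesis
      unfolding T_def commutators_with_def image_image Setcompr_eq_image by (rule image_cong[OF refl])
  qed
  have "inj_on (\<lambda>u. inv u \<otimes> x) (carrier G)"
    using x by (intro inj_onI) (metis inv_closed inv_inv right_cancel)
  then have card_T: "card T = card (conjugate G x ` A)"
    unfolding T_image using AG x by (intro card_image) (auto elim: inj_on_subset)
  have T_inv: "conjugate G t h \<in> T" if t: "t \<in> T" and h: "h \<in> H" for t h
  proof -
    obtain b c where bc: "b \<in> A" "c \<in> C" "h = b \<otimes> c"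
      using h unfolding H_def set_mult_def by blast
    have G: "b \<in> carrier G" "c \<in> carrier G" using bc AG CG by auto
    have tG: "t \<in> carrier G"
      using t AG x by (auto simp: T_def commutators_with_def)
    \<comment> \<open>The factor in \<open>A\<close> preserves \<open>T\<close> by hypothesis, the factor in \<open>C\<close> because it fixes \<open>x\<close>.\<close>
    have "conjugate G t b \<in> T"
      using norm bc t unfolding normal_subset_def T_def conjugate_def by blast
    then obtain d where d: "d \<in> A" "conjugate G t b = commutator G d x"
      unfolding T_def commutators_with_def by blast
    have dG: "d \<in> carrier G" using d AG by blast
    have "conjugate G t h = commutator G (conjugate G d c) x"
      using bc G tG dG x by (simp add: conjugate_by_mult d(2) conjugate_commutator x_fixed)
    moreover have "conjugate G d c \<in> A"
      unfolding conjugate_def using normal.inv_op_closed1[OF A] G d by blast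
    ultimately show ?thesis unfolding T_def commutators_with_def by blast
  qed
  have one_T: "\<one> \<in> T"
    unfolding T_def commutators_with_def using subgroup.one_closed[OF subA] x
    by (auto simp: commutator_def intro!: exI[of _ \<one>])
  have orbit_y: "conjugate G y ` H \<subseteq> T - {\<one>}"
  proof (clarify, intro DiffI)
    fix h assume h: "h \<in> H"
    show "conjugate G y h \<in> T"
      using h a by (intro T_inv) (auto simp: y_def T_def commutators_with_def)
    have "conjugate G y h \<noteq> \<one>"
      using h HG yG ne by (auto simp: conjugate_eq_iff y_def)
    then show "conjugate G y h \<notin> {\<one>}" by simp
  qed
  have finT: "finite T"
    unfolding T_image using AG fin finite_subset by blast
  have "card (conjugate G y ` H) \<le> card (T - {\<one>})"
    using orbit_y finT by (intro card_mono) auto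
  also have "\<dots> < card T" using one_T finT by (intro psubset_card_mono) auto
  also have "card T = card (conjugate G x ` H)"
  proof -
    have "A \<subseteq> H"
    proof
      fix b assume "b \<in> A"
      moreover from this have "b = b \<otimes> \<one>" using AG by auto
      ultimately show "b \<in> H"
        unfolding H_def set_mult_def using subgroup.one_closed[OF subC] by blast
    qed
    then have "conjugate G x ` A = conjugate G x ` H" using orbit_x by blast
    with card_T show ?thesis by simp
  qed
  finally have less: "card (conjugate G y ` H) < card (conjugate G x ` H)" .
  have ordx: "card (conjugate G x ` H) * card C = card H"
    using card_conjugates_mult_centralizer[OF fin subH x] CH
    by (simp add: C_def inf_absorb2)
  have ordy: "card (conjugate G y ` H) * card (H \<inter> centralizer G {y}) = card H"
    using card_conjugates_mult_centralizer[OF fin subH yG] .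
  have posH: "card H > 0" using finH subgroup.one_closed[OF subH] by (auto simp: card_gt_0_iff)
  have "card C < card (H \<inter> centralizer G {y})"
  proof (rule ccontr)
    assume "\<not> ?thesis"
    then have "card (conjugate G y ` H) * card (H \<inter> centralizer G {y})
        \<le> card (conjugate G y ` H) * card C" by simp
    also have "\<dots> < card (conjugate G x ` H) * card C"
      using less posH ordx by (intro mult_strict_right_mono) (auto intro: Nat.gr0I)
    finally show False using ordx ordy by simp
  qed
  also have "\<dots> \<le> card (centralizer G {y})"
    using fin by (intro card_mono) (auto simp: centralizer_def)
  finally show ?thesis by (simp add: C_def y_def)
qed

lemma commutator_small_central:
  assumes fin: "finite (carrier G)" and A: "A \<lhd> G" and x: "x \<in> small_elements G"
    and norm: "normal_subset G A (commutators_with G A x)" and a: "a \<in> A"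
  shows "commutator G a x \<in> group_center G"
proof (cases "commutator G a x = \<one>")
  case True
  then show ?thesis by (simp add: group_center_iff)
next
  case False
  have xG: "x \<in> carrier G" using x by (simp add: small_elements_def)
  have aG: "a \<in> carrier G" using a subgroup.subset[OF normal_imp_subgroup[OF A]] by blast
  have cG: "commutator G a x \<in> carrier G" using aG xG by simp
  have "card (conj_class G (commutator G a x)) < card (conj_class G x)"
    using card_conj_class_less[OF fin xG cG]
      card_centralizer_commutator_less[OF fin A xG norm a False] by blast
  then show ?thesis
    using x cG by (auto simp: small_elements_def simp flip: not_le)
qed

section \<open>Central commutators\<close>

text \<open>An inverse-free form of centrality: \<open>g\<close> conjugates \<open>a\<close> to \<open>a z\<close> with \<open>z\<close> central. In this
  form products of such \<open>g\<close> can be handled by collecting the central factors on the right.\<close>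

lemma commutator_central_iff:
  assumes a: "a \<in> carrier G" and g: "g \<in> carrier G"
  shows "commutator G a g \<in> group_center G \<longleftrightarrow> (\<exists>z \<in> group_center G. a \<otimes> g = g \<otimes> (a \<otimes> z))"
proof
  assume c: "commutator G a g \<in> group_center G"
  have "a \<otimes> g = g \<otimes> (a \<otimes> commutator G a g)"
    using a g by (simp add: commutator_def m_assoc mult_inv_cancel_left)
  with c show "\<exists>z \<in> group_center G. a \<otimes> g = g \<otimes> (a \<otimes> z)" by blast
next
  assume "\<exists>z \<in> group_center G. a \<otimes> g = g \<otimes> (a \<otimes> z)"
  then obtain z where z: "z \<in> group_center G" "a \<otimes> g = g \<otimes> (a \<otimes> z)" by blast
  have zG: "z \<in> carrier G" using z by (simp add: group_center_iff)
  have "commutator G a g = inv a \<otimes> (inv g \<otimes> (a \<otimes> g))"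
    using a g by (simp add: commutator_def m_assoc)
  also have "\<dots> = z"
    using z(2) a g zG by (simp add: mult_inv_cancel_left)
  finally show "commutator G a g \<in> group_center G" using z by simp
qed

text \<open>The elements that conjugate \<open>a\<close> to \<open>a z\<close> for some central \<open>z\<close> form a subgroup: composing
  two of them multiplies the central factors, and inverting one inverts its factor.\<close>

lemma commutator_generate_central:
  assumes S: "S \<subseteq> carrier G" and a: "a \<in> carrier G"
    and gens: "\<And>s. s \<in> S \<Longrightarrow> commutator G a s \<in> group_center G"
    and g: "g \<in> generate G S"
  shows "commutator G a g \<in> group_center G"
proof -
  have Z: "subgroup (group_center G) G"
    unfolding group_center_def by (rule subgroup_centralizer) simp
  have ZG: "z \<in> carrier G" if "z \<in> group_center G" for z
    using that by (simp add: group_center_iff)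
  have Zc: "z \<otimes> h = h \<otimes> z" if "z \<in> group_center G" "h \<in> carrier G" for z h
    using that by (simp add: group_center_iff)
  show ?thesis
    using g
  proof (induction g rule: generate.induct)
    case one
    then show ?case using a by (simp add: commutator_def subgroup.one_closed[OF Z])
  next
    case (incl h)
    then show ?case by (rule gens)
  next
    case (inv h)
    have h: "h \<in> carrier G" using inv S by blast
    obtain z where z: "z \<in> group_center G" "a \<otimes> h = h \<otimes> (a \<otimes> z)"
      using gens[OF inv] commutator_central_iff[OF a h] by blast
    have zG: "z \<in> carrier G" using z ZG by blast
    have "z \<otimes> (inv h \<otimes> inv z) = inv h"
      using h zG Zc[OF z(1), of "inv h \<otimes> inv z"] by (simp add: m_assoc)
    then have "h \<otimes> (a \<otimes> inv h) = h \<otimes> (a \<otimes> z) \<otimes> (inv h \<otimes> inv z)"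
      using a h zG by (simp add: m_assoc)
    also have "\<dots> = a \<otimes> h \<otimes> (inv h \<otimes> inv z)" by (simp only: z(2))
    also have "\<dots> = a \<otimes> inv z" using a h zG by (simp add: m_assoc mult_inv_cancel_left)
    finally have "a \<otimes> inv h = inv h \<otimes> (a \<otimes> inv z)"
      using a h zG by (simp add: inv_solve_left)
    then show ?case
      using commutator_central_iff[OF a, of "inv h"] h subgroup.m_inv_closed[OF Z z(1)] by auto
  next
    case (eng h k)
    have hk: "h \<in> carrier G" "k \<in> carrier G"
      using eng.hyps generate_in_carrier[OF S] by auto
    obtain z where z: "z \<in> group_center G" "a \<otimes> h = h \<otimes> (a \<otimes> z)"
      using eng.IH(1) commutator_central_iff[OF a hk(1)] by blast
    obtain w where w: "w \<in> group_center G" "a \<otimes> k = k \<otimes> (a \<otimes> w)"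
      using eng.IH(2) commutator_central_iff[OF a hk(2)] by blast
    have zw: "z \<in> carrier G" "w \<in> carrier G" using z w ZG by auto
    have "a \<otimes> (h \<otimes> k) = h \<otimes> (a \<otimes> z) \<otimes> k"
      using z(2) a hk by (simp flip: m_assoc)
    also have "\<dots> = h \<otimes> (a \<otimes> k) \<otimes> z"
      using a hk zw Zc[OF z(1) hk(2)] by (simp add: m_assoc)
    also have "\<dots> = (h \<otimes> k) \<otimes> (a \<otimes> (w \<otimes> z))"
      using w(2) a hk zw by (simp add: m_assoc)
    finally show ?case
      using commutator_central_iff[OF a, of "h \<otimes> k"] hk subgroup.m_closed[OF Z w(1) z(1)] by auto
  qed
qed

text \<open>Both \<open>g\<close> and \<open>h\<close> multiply \<open>a\<close> by central elements \<open>z\<close> and \<open>w\<close>, so \<open>g h\<close> and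
  \<open>h g\<close> both multiply it by \<open>w z\<close>; their quotient, which is the commutator, fixes \<open>a\<close>. This
  takes the place of the three subgroups lemma.\<close>

lemma commutator_centralizes:
  assumes G: "a \<in> carrier G" "g \<in> carrier G" "h \<in> carrier G"
    and "commutator G a g \<in> group_center G" "commutator G a h \<in> group_center G"
  shows "commutator G g h \<otimes> a = a \<otimes> commutator G g h"
proof -
  let ?c = "commutator G g h"
  obtain z where z: "z \<in> group_center G" "a \<otimes> g = g \<otimes> (a \<otimes> z)"
    using assms commutator_central_iff by blast
  obtain w where w: "w \<in> group_center G" "a \<otimes> h = h \<otimes> (a \<otimes> w)"
    using assms commutator_central_iff by blast
  have zw: "z \<in> carrier G" "w \<in> carrier G" using z w by (auto simp: group_center_iff)
  have Z: "z \<otimes> u = u \<otimes> z" "w \<otimes> u = u \<otimes> w" if "u \<in> carrier G" for u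
    using that z w by (auto simp: group_center_iff)
  have c: "?c \<in> carrier G" using G by simp
  have gh: "g \<otimes> h = h \<otimes> (g \<otimes> ?c)"
    using G by (simp add: commutator_def m_assoc mult_inv_cancel_left)
  have 1: "a \<otimes> (g \<otimes> h) = g \<otimes> h \<otimes> (a \<otimes> (w \<otimes> z))"
  proof -
    have "a \<otimes> (g \<otimes> h) = g \<otimes> (a \<otimes> z) \<otimes> h" using z(2) G by (simp flip: m_assoc)
    also have "\<dots> = g \<otimes> (a \<otimes> h) \<otimes> z" using G zw Z(1)[of h] by (simp add: m_assoc)
    finally show ?thesis using w(2) G zw by (simp add: m_assoc)
  qed
  have 2: "a \<otimes> (h \<otimes> g) = h \<otimes> g \<otimes> (a \<otimes> (w \<otimes> z))"
  proof -
    have "a \<otimes> (h \<otimes> g) = h \<otimes> (a \<otimes> w) \<otimes> g" using w(2) G by (simp flip: m_assoc)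
    also have "\<dots> = h \<otimes> (a \<otimes> g) \<otimes> w" using G zw Z(2)[of g] by (simp add: m_assoc)
    finally show ?thesis using z(2) G zw Z(1)[of w] by (simp add: m_assoc)
  qed
  have "h \<otimes> g \<otimes> (?c \<otimes> a \<otimes> (w \<otimes> z)) = a \<otimes> (h \<otimes> g) \<otimes> ?c"
    using 1 G c zw gh by (simp add: m_assoc)
  also have "\<dots> = h \<otimes> g \<otimes> (a \<otimes> (w \<otimes> z \<otimes> ?c))"
    using 2 G c zw by (simp add: m_assoc)
  also have "w \<otimes> z \<otimes> ?c = ?c \<otimes> (w \<otimes> z)"
  proof -
    have "w \<otimes> z \<otimes> ?c = w \<otimes> ?c \<otimes> z" using Z(1)[OF c] c zw by (simp add: m_assoc)
    also have "\<dots> = ?c \<otimes> w \<otimes> z" by (simp only: Z(2)[OF c])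
    finally show ?thesis using c zw by (simp add: m_assoc)
  qed
  also have "h \<otimes> g \<otimes> (a \<otimes> (?c \<otimes> (w \<otimes> z))) = h \<otimes> g \<otimes> (a \<otimes> ?c \<otimes> (w \<otimes> z))"
    using G c zw by (simp add: m_assoc)
  finally show ?thesis using G c zw by simp
qed

section \<open>The lower central series of a subgroup\<close>

lemma commutator_subgroup_carrier:
  assumes "subgroup M G" "x \<in> M" "g \<in> M"
  shows "commutator (G\<lparr>carrier := M\<rparr>) x g = commutator G x g"
  using assms by (simp add: commutator_def)

lemma lower_central_subset:
  assumes M: "subgroup M G"
  shows "lower_central (G\<lparr>carrier := M\<rparr>) n \<subseteq> M"
proof -
  interpret M: group "G\<lparr>carrier := M\<rparr>" using M by (rule subgroup_imp_group)
  show ?thesis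
  proof (induction n)
    case (Suc n)
    have "generate (G\<lparr>carrier := M\<rparr>) {commutator (G\<lparr>carrier := M\<rparr>) x g |x g.
        x \<in> lower_central (G\<lparr>carrier := M\<rparr>) n \<and> g \<in> M} \<subseteq> carrier (G\<lparr>carrier := M\<rparr>)"
      using Suc by (intro M.generate_incl) (auto dest!: subsetD intro!: M.commutator_closed[simplified])
    then show ?case by simp
  qed simp
qed

text \<open>Bounds the terms of the series of \<open>M\<close> by subgroups of the ambient group that need not lie
  in \<open>M\<close>, such as the centre of \<open>G\<close>; the commutators are those of \<open>G\<close>.\<close>

lemma lower_central_Suc_subset:
  assumes M: "subgroup M G" and K: "subgroup K G"
    and comm: "\<And>x g. x \<in> lower_central (G\<lparr>carrier := M\<rparr>) n \<Longrightarrow> g \<in> M \<Longrightarrow> commutator G x g \<in> K"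
  shows "lower_central (G\<lparr>carrier := M\<rparr>) (Suc n) \<subseteq> K"
proof -
  let ?S = "{commutator G x g |x g. x \<in> lower_central (G\<lparr>carrier := M\<rparr>) n \<and> g \<in> M}"
  have LM: "x \<in> M" if "x \<in> lower_central (G\<lparr>carrier := M\<rparr>) n" for x
    using lower_central_subset[OF M] that by blast
  have "?S \<subseteq> M"
    using LM by (auto simp: commutator_def intro!: subgroup.m_closed[OF M] subgroup.m_inv_closed[OF M])
  have "{commutator (G\<lparr>carrier := M\<rparr>) x g |x g. x \<in> lower_central (G\<lparr>carrier := M\<rparr>) n \<and> g \<in> M} = ?S"
    using LM by (force simp: commutator_subgroup_carrier[OF M])
  then have "lower_central (G\<lparr>carrier := M\<rparr>) (Suc n) = generate G ?S"
    using generate_consistent[OF \<open>?S \<subseteq> M\<close> M] by simp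
  also have "\<dots> \<subseteq> K"
    using K comm by (intro generate_subgroup_incl) auto
  finally show ?thesis .
qed

text \<open>The successive terms of the series are contained in the centralizer of \<open>A\<close>, in the centre of
  \<open>G\<close>, and in the trivial subgroup. The hypothesis that \<open>A\<close> contains its centralizer is what
  allows centrality of the commutators of \<open>A\<close> with \<open>M\<close> to be applied to the first term.\<close>

lemma lower_central_3_trivial:
  assumes M: "subgroup M G" and AG: "A \<subseteq> carrier G" and CA: "centralizer G A \<subseteq> A"
    and central: "\<And>a g. a \<in> A \<Longrightarrow> g \<in> M \<Longrightarrow> commutator G a g \<in> group_center G"
  shows "lower_central (G\<lparr>carrier := M\<rparr>) 3 = {\<one>}"
proof -
  let ?L = "lower_central (G\<lparr>carrier := M\<rparr>)"
  have MG: "M \<subseteq> carrier G" using M by (rule subgroup.subset)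
  have Z: "subgroup (group_center G) G"
    unfolding group_center_def by (rule subgroup_centralizer) simp
  have L1: "?L (Suc 0) \<subseteq> centralizer G A"
  proof (rule lower_central_Suc_subset[OF M subgroup_centralizer[OF AG]])
    fix x g assume "x \<in> ?L 0" "g \<in> M"
    then have "x \<in> M" "x \<in> carrier G" "g \<in> carrier G" using MG by auto
    then show "commutator G x g \<in> centralizer G A"
      using AG \<open>g \<in> M\<close> commutator_centralizes central by (auto simp: centralizer_def subset_iff)
  qed
  have L2: "?L (Suc (Suc 0)) \<subseteq> group_center G"
    using L1 CA central by (intro lower_central_Suc_subset[OF M Z]) blast
  have "?L (Suc (Suc (Suc 0))) \<subseteq> {\<one>}"
  proof (rule lower_central_Suc_subset[OF M triv_subgroup])
    fix x g assume "x \<in> ?L (Suc (Suc 0))" "g \<in> M"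
    then have "x \<in> group_center G" "g \<in> carrier G" using L2 MG by auto
    then show "commutator G x g \<in> {\<one>}"
      by (simp add: group_center_iff commutator_def m_assoc mult_inv_cancel_left)
  qed
  moreover have "\<one> \<in> ?L (Suc (Suc (Suc 0)))"
    using generate.one[of "G\<lparr>carrier := M\<rparr>"] by simp
  ultimately show ?thesis unfolding numeral_3_eq_3 by blast
qed

end

theorem theoremC:
  fixes G :: "('a, 'b) monoid_scheme" and A :: "'a set"
  assumes "group G" and "finite (carrier G)"
    and "A \<lhd> G"
    and "centralizer G A \<subseteq> A"
    and "\<And>x. x \<in> small_elements G \<Longrightarrow> normal_subset G A (commutators_with G A x)"
  shows "nilpotent_group (G\<lparr>carrier := small_subgroup G\<rparr>)
    \<and> nilpotency_class (G\<lparr>carrier := small_subgroup G\<rparr>) \<le> 3"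
proof -
  interpret group G by fact
  let ?M = "small_subgroup G"
  have SG: "small_elements G \<subseteq> carrier G" by (auto simp: small_elements_def)
  have M: "subgroup ?M G"
    unfolding small_subgroup_def by (rule generate_is_subgroup[OF SG])
  have AG: "A \<subseteq> carrier G"
    using assms(3) by (intro subgroup.subset normal_imp_subgroup)
  have "commutator G a g \<in> group_center G" if "a \<in> A" "g \<in> ?M" for a g
  proof (rule commutator_generate_central[OF SG])
    show "a \<in> carrier G" "g \<in> generate G (small_elements G)"
      using that AG by (auto simp: small_subgroup_def)
    show "commutator G a s \<in> group_center G" if "s \<in> small_elements G" for s
      using commutator_small_central[OF assms(2,3) that assms(5)[OF that] \<open>a \<in> A\<close>] .
  qed
  then have *: "lower_central (G\<lparr>carrier := ?M\<rparr>) 3 = {\<one>\<^bsub>G\<^esub>}"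
    using M AG assms(4) by (intro lower_central_3_trivial)
  have "nilpotent_group (G\<lparr>carrier := ?M\<rparr>)"
    unfolding nilpotent_group_def using * subgroup_imp_group[OF M] by auto
  moreover have "nilpotency_class (G\<lparr>carrier := ?M\<rparr>) \<le> 3"
    unfolding nilpotency_class_def using * by (intro Least_le) simp
  ultimately show ?thesis by simp
qed

end
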